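(* For any strongly non-nilpotent complex structure $J$ on an $8$-dimensional real nilpotent Lie algebra $\mathfrak g$, the dimension of the Lie-algebra Dolbeault cohomology group $H^{0,1}_{\bar\partial}(\mathfrak g,J)$ is either $2$ or $3$.
   Context: A complex structure on a real Lie algebra $\mathfrak g$ is an endomorphism $J$ with $J^2=-\mathrm{Id}$ and $[X,Y]+J[JX,Y]+J[X,JY]-[JX,JY]=0$ for all $X,Y$. A complex structure $J$ on a nilpotent Lie algebra $\mathfrak g$ is strongly non-nilpotent (SnN) if $\mathfrak a_1(J)=\{X\in\mathfrak g\mid [X,\mathfrak g]=0 \text{ and } [JX,\mathfrak g]=0\}$, the largest $J$-invariant subspace of the center, is $\{0\}$. Let $\mathfrak g_{\mathbb C}^*$ be the dual of the complexification, with $J$ acting by $(J\alpha)(X)=\alpha(JX)$; $\mathfrak g^{1,0}_J$ and $\mathfrak g^{0,1}_J$ are the eigenspaces for $i$ and $-i$, and $\mathfrak g^{p,q}_J$ is the induced bigraduation of $\bigwedge^*\mathfrak g^*_{\mathbb C}$. The complexified Chevalley–Eilenberg differential splits as $d=\partial+\bar\partial$ with $\bar\partial:\mathfrak g^{p,q}_J\to\mathfrak g^{p,q+1}_J$ (the projection of $d$), and $$H^{p,q}_{\bar\partial}(\mathfrak g,J)=\ker\{\bar\partial:\mathfrak g^{p,q}_J\to\mathfrak g^{p,q+1}_J\}/\operatorname{im}\{\bar\partial:\mathfrak g^{p,q-1}_J\to\mathfrak g^{p,q}_J\};$$ in particular $H^{0,1}_{\bar\partial}(\mathfrak g,J)=\ker\{\bar\partial:\mathfrak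 g^{0,1}_J\to\mathfrak g^{0,2}_J\}$. Dimensions are over $\mathbb C$. *)

theory Defs
  imports "HOL-Analysis.Analysis" "HOL-Library.Function_Algebras"
begin

section \<open>Real Lie algebras and complex structures\<close>

definition lie_algebra :: "('g::real_vector \<Rightarrow> 'g \<Rightarrow> 'g) \<Rightarrow> bool" where
  "lie_algebra br \<longleftrightarrow> bilinear br \<and> (\<forall>X. br X X = 0) \<and>
     (\<forall>X Y Z. br X (br Y Z) + br Y (br Z X) + br Z (br X Y) = 0)"

primrec lower_central :: "('g::real_vector \<Rightarrow> 'g \<Rightarrow> 'g) \<Rightarrow> nat \<Rightarrow> 'g set" where
  "lower_central br 0 = UNIV"
| "lower_central br (Suc n) = span {br X Y | X Y. Y \<in> lower_central br n}"

definition nilpotent_lie_algebra :: "('g::real_vector \<Rightarrow> 'g \<Rightarrow> 'g) \<Rightarrow> bool" where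
  "nilpotent_lie_algebra br \<longleftrightarrow> lie_algebra br \<and> (\<exists>n. lower_central br n = {0})"

definition complex_structure ::
    "('g::real_vector \<Rightarrow> 'g \<Rightarrow> 'g) \<Rightarrow> ('g \<Rightarrow> 'g) \<Rightarrow> bool" where
  "complex_structure br J \<longleftrightarrow> linear J \<and> (\<forall>X. J (J X) = - X) \<and>
     (\<forall>X Y. br X Y + J (br (J X) Y) + J (br X (J Y)) - br (J X) (J Y) = 0)"

definition ascending_a1 ::
    "('g::real_vector \<Rightarrow> 'g \<Rightarrow> 'g) \<Rightarrow> ('g \<Rightarrow> 'g) \<Rightarrow> 'g set" where
  "ascending_a1 br J = {X. (\<forall>Y. br X Y = 0) \<and> (\<forall>Y. br (J X) Y = 0)}"

definition SnN_complex_structure ::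
    "('g::real_vector \<Rightarrow> 'g \<Rightarrow> 'g) \<Rightarrow> ('g \<Rightarrow> 'g) \<Rightarrow> bool" where
  "SnN_complex_structure br J \<longleftrightarrow>
     nilpotent_lie_algebra br \<and> complex_structure br J \<and> ascending_a1 br J = {0}"


section \<open>The complexification\<close>

text \<open>The pair \<open>(X, Y)\<close> stands for \<open>X + i Y\<close>.\<close>

type_synonym 'g complexification = "'g \<times> 'g"

definition cscale :: "complex \<Rightarrow> 'g::real_vector complexification \<Rightarrow> 'g complexification" where
  "cscale c Z = (Re c *\<^sub>R fst Z - Im c *\<^sub>R snd Z, Re c *\<^sub>R snd Z + Im c *\<^sub>R fst Z)"

global_interpretation cplx: vector_space "cscale :: complex \<Rightarrow> 'g::real_vector \<times> 'g \<Rightarrow> _"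
  by standard (auto simp: cscale_def prod_eq_iff algebra_simps)

definition cbracket :: "('g::real_vector \<Rightarrow> 'g \<Rightarrow> 'g) \<Rightarrow>
    'g complexification \<Rightarrow> 'g complexification \<Rightarrow> 'g complexification" where
  "cbracket br Z W = (br (fst Z) (fst W) - br (snd Z) (snd W),
                      br (fst Z) (snd W) + br (snd Z) (fst W))"

definition cmap :: "('g \<Rightarrow> 'g) \<Rightarrow> 'g complexification \<Rightarrow> 'g complexification" where
  "cmap J Z = (J (fst Z), J (snd Z))"


section \<open>Exterior forms and their bigraduation\<close>

text \<open>A \<open>k\<close>-form is represented by its values on lists of \<open>k\<close> vectors and is extended by \<open>0\<close>
  to lists of any other length.  The whole exterior algebra of the dual of the complexification
  then consists of the finite sums of such functions.\<close>

type_synonym 'g form = "'g complexification list \<Rightarrow> complex"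

global_interpretation cform: vector_space "\<lambda>(c::complex) (f :: 'a \<Rightarrow> complex) x. c * f x"
  defines cform_span = cform.span
  by standard (auto simp: fun_eq_iff algebra_simps)

text \<open>\<open>\<alpha>\<^sub>1 \<and> \<dots> \<and> \<alpha>\<^sub>k\<close>, with the convention
  \<open>(\<alpha>\<^sub>1 \<and> \<dots> \<and> \<alpha>\<^sub>k) (Z\<^sub>1, \<dots>, Z\<^sub>k) = det (\<alpha>\<^sub>i Z\<^sub>j)\<close>; the empty product is the constant \<open>1\<close>.\<close>

definition wedge :: "('g complexification \<Rightarrow> complex) list \<Rightarrow> 'g form" where
  "wedge as Zs = (if length Zs = length as
     then (\<Sum>\<sigma> | \<sigma> permutes {..<length as}.
             of_int (sign \<sigma>) * (\<Prod>i<length as. (as ! i) (Zs ! \<sigma> i)))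
     else 0)"

definition dual_eigenspace ::
    "('g::real_vector \<Rightarrow> 'g) \<Rightarrow> complex \<Rightarrow> ('g complexification \<Rightarrow> complex) set" where
  "dual_eigenspace J c = {\<alpha>. Vector_Spaces.linear cscale (*) \<alpha> \<and>
                             (\<forall>Z. \<alpha> (cmap J Z) = c * \<alpha> Z)}"

definition bidegree_forms :: "('g::real_vector \<Rightarrow> 'g) \<Rightarrow> nat \<Rightarrow> nat \<Rightarrow> 'g form set" where
  "bidegree_forms J p q = cform_span {wedge (as @ bs) | as bs.
     length as = p \<and> set as \<subseteq> dual_eigenspace J \<i> \<and>
     length bs = q \<and> set bs \<subseteq> dual_eigenspace J (- \<i>)}"

text \<open>The component of a form in bidegree \<open>(p, q)\<close> with respect to the decomposition of the
  exterior algebra as the direct sum of all its bidegree subspaces.\<close>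

definition bidegree_part ::
    "('g::real_vector \<Rightarrow> 'g) \<Rightarrow> nat \<Rightarrow> nat \<Rightarrow> 'g form \<Rightarrow> 'g form" where
  "bidegree_part J p q \<eta> = (THE \<beta>. \<beta> \<in> bidegree_forms J p q \<and>
     \<eta> - \<beta> \<in> cform_span (\<Union>{bidegree_forms J r s | r s. (r, s) \<noteq> (p, q)}))"


section \<open>Lie-algebra Dolbeault cohomology\<close>

text \<open>The Chevalley--Eilenberg differential
  \<open>d\<alpha> (Z\<^sub>0, \<dots>, Z\<^sub>k) = \<Sum>\<^bsub>i<j\<^esub> (-1)\<^bsup>i+j\<^esup> \<alpha> ([Z\<^sub>i, Z\<^sub>j], Z\<^sub>0, \<dots>, Z\<^sub>k)\<close>, where \<open>Z\<^sub>i\<close> and \<open>Z\<^sub>j\<close>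
  are omitted from the remaining arguments; thus \<open>d\<alpha> (X, Y) = - \<alpha> [X, Y]\<close> on 1-forms.\<close>

definition ce_differential ::
    "('g::real_vector \<Rightarrow> 'g \<Rightarrow> 'g) \<Rightarrow> 'g form \<Rightarrow> 'g form" where
  "ce_differential br \<alpha> Zs = (\<Sum>j<length Zs. \<Sum>i<j.
     (- 1) ^ (i + j) * \<alpha> (cbracket br (Zs ! i) (Zs ! j) # nths Zs (- {i, j})))"

definition delbar :: "('g::real_vector \<Rightarrow> 'g \<Rightarrow> 'g) \<Rightarrow> ('g \<Rightarrow> 'g) \<Rightarrow>
    nat \<Rightarrow> nat \<Rightarrow> 'g form \<Rightarrow> 'g form" where
  "delbar br J p q \<alpha> = bidegree_part J p (Suc q) (ce_differential br \<alpha>)"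

definition dolbeault_cocycles :: "('g::real_vector \<Rightarrow> 'g \<Rightarrow> 'g) \<Rightarrow> ('g \<Rightarrow> 'g) \<Rightarrow>
    nat \<Rightarrow> nat \<Rightarrow> 'g form set" where
  "dolbeault_cocycles br J p q = {\<alpha> \<in> bidegree_forms J p q. delbar br J p q \<alpha> = 0}"

definition dolbeault_coboundaries :: "('g::real_vector \<Rightarrow> 'g \<Rightarrow> 'g) \<Rightarrow> ('g \<Rightarrow> 'g) \<Rightarrow>
    nat \<Rightarrow> nat \<Rightarrow> 'g form set" where
  "dolbeault_coboundaries br J p q = (case q of 0 \<Rightarrow> {0}
     | Suc q' \<Rightarrow> delbar br J p q' ` bidegree_forms J p q')"

text \<open>For subspaces \<open>W \<subseteq> V\<close>, the classes modulo \<open>W\<close> of the elements of \<open>B\<close> are pairwise distinct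
  and form a basis of \<open>V/W\<close>.\<close>

definition quotient_basis ::
    "('a \<Rightarrow> complex) set \<Rightarrow> ('a \<Rightarrow> complex) set \<Rightarrow> ('a \<Rightarrow> complex) set \<Rightarrow> bool" where
  "quotient_basis V W B \<longleftrightarrow> finite B \<and> B \<subseteq> V \<and>
     (\<forall>c. (\<lambda>x. \<Sum>b\<in>B. c b * b x) \<in> W \<longrightarrow> (\<forall>b\<in>B. c b = 0)) \<and>
     (\<forall>v\<in>V. \<exists>c. v - (\<lambda>x. \<Sum>b\<in>B. c b * b x) \<in> W)"

definition quotient_dim :: "('a \<Rightarrow> complex) set \<Rightarrow> ('a \<Rightarrow> complex) set \<Rightarrow> nat" where
  "quotient_dim V W = (THE n. \<exists>B. quotient_basis V W B \<and> card B = n)"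

text \<open>The complex dimension of the Dolbeault cohomology group of bidegree \<open>(p, q)\<close>.\<close>

definition dolbeault_dim :: "('g::real_vector \<Rightarrow> 'g \<Rightarrow> 'g) \<Rightarrow> ('g \<Rightarrow> 'g) \<Rightarrow>
    nat \<Rightarrow> nat \<Rightarrow> nat" where
  "dolbeault_dim br J p q =
     quotient_dim (dolbeault_cocycles br J p q) (dolbeault_coboundaries br J p q)"

end

theory Submission
  imports Defs
begin

text \<open>The eigenspace \<open>q = V01\<close> of \<open>J\<close> for \<open>-\<i>\<close> is a complex nilpotent Lie algebra of dimension 4,
  and a form of bidegree \<open>(0, 1)\<close> is a cocycle iff its restriction to \<open>q\<close> kills \<open>[q, q]\<close>; hence the
  cohomology is the dual of \<open>q/[q, q]\<close>.  If this quotient had dimension at most 1, that is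
  \<open>q = \<complex>e + [q, q]\<close>, then nilpotency would force \<open>[q, q] = 0\<close>.  But \<open>[q, q] = 0\<close> is impossible: it
  means \<open>[JX, JY] = [X, Y]\<close>, which makes the (nonzero) center invariant under \<open>J\<close>.\<close>

declare split_paired_All [simp del] split_paired_Ex [simp del]

section \<open>Linear forms on the complexification; wedges of one or two of them\<close>

lemma sum_fun_apply: "(\<Sum>a\<in>A. f a) x = (\<Sum>a\<in>A. f a x)"
  by (induction A rule: infinite_finite_induct) auto

lemma sum_fun_eq: "(\<Sum>a\<in>A. f a) = (\<lambda>x. \<Sum>a\<in>A. f a x)"
  by (rule ext) (rule sum_fun_apply)

abbreviation clinear_form :: "('g::real_vector complexification \<Rightarrow> complex) \<Rightarrow> bool" where
  "clinear_form \<equiv> Vector_Spaces.linear cscale (*)"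

lemma clinear_form_iff:
  "clinear_form \<alpha> \<longleftrightarrow> (\<forall>Z W. \<alpha> (Z + W) = \<alpha> Z + \<alpha> W) \<and> (\<forall>c Z. \<alpha> (cscale c Z) = c * \<alpha> Z)"
proof -
  have "vector_space ((*) :: complex \<Rightarrow> complex \<Rightarrow> complex)"
    by standard (auto simp: algebra_simps)
  then show ?thesis
    unfolding Vector_Spaces.linear_iff by (auto intro: cplx.vector_space_axioms)
qed

lemma clinear_form_add: "clinear_form \<alpha> \<Longrightarrow> \<alpha> (Z + W) = \<alpha> Z + \<alpha> W"
  and clinear_form_scale: "clinear_form \<alpha> \<Longrightarrow> \<alpha> (cscale c Z) = c * \<alpha> Z"
  by (auto simp: clinear_form_iff)

lemma clinear_form_zero: "clinear_form \<alpha> \<Longrightarrow> \<alpha> 0 = 0"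
  by (metis add_cancel_right_right clinear_form_add)

lemma clinear_form_sum: "clinear_form \<alpha> \<Longrightarrow> \<alpha> (\<Sum>a\<in>A. f a) = (\<Sum>a\<in>A. \<alpha> (f a))"
  by (induction A rule: infinite_finite_induct) (auto simp: clinear_form_add clinear_form_zero)

lemma wedge_singleton: "wedge [a] Zs = (if length Zs = 1 then a (Zs ! 0) else 0)"
proof -
  have "{..<Suc 0} = {0}" by auto
  then show ?thesis by (auto simp: wedge_def sign_id)
qed

lemma wedge_pair:
  "wedge [a, b] Zs = (if length Zs = 2 then a (Zs ! 0) * b (Zs ! 1) - a (Zs ! 1) * b (Zs ! 0) else 0)"
proof -
  have *: "{..<Suc (Suc 0)} = {0, 1}" by auto
  have "id \<noteq> Transposition.transpose (0::nat) 1"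
    by (metis id_apply transpose_apply_first zero_neq_one)
  then show ?thesis
    by (auto simp: wedge_def * permutes_doubleton_iff sign_id sign_swap_id
        conj_disj_distribR Collect_disj_eq numeral_2_eq_2)
qed

section \<open>Eigenspaces of \<open>J\<close> and forms of bidegree (0, q)\<close>

locale almost_complex =
  fixes J :: "'g::real_vector \<Rightarrow> 'g"
  assumes linear_J: "linear J" and J_J: "J (J X) = - X"
begin

lemmas J_add = linear_add[OF linear_J]
  and J_diff = linear_diff[OF linear_J]
  and J_neg = linear_neg[OF linear_J]
  and J_scale = linear_scale[OF linear_J]

lemmas J_simps = J_add J_diff J_neg J_scale J_J

text \<open>The \<open>-\<i>\<close>-eigenspace of \<open>J\<close> on the complexification.\<close>

definition V01 :: "'g complexification set" where
  "V01 = {Z. snd Z = J (fst Z)}"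

text \<open>In pair notation this is \<open>(1 + \<i> J)/2\<close>, the projection onto the
  \<open>-\<i>\<close>-eigenspace along the \<open>\<i>\<close>-eigenspace; \<open>pr10\<close> is
  the complementary \<open>(1 - \<i> J)/2\<close>.\<close>

definition pr01 :: "'g complexification \<Rightarrow> 'g complexification" where
  "pr01 Z = ((1/2) *\<^sub>R (fst Z - J (snd Z)), (1/2) *\<^sub>R (snd Z + J (fst Z)))"

definition pr10 :: "'g complexification \<Rightarrow> 'g complexification" where
  "pr10 Z = ((1/2) *\<^sub>R (fst Z + J (snd Z)), (1/2) *\<^sub>R (snd Z - J (fst Z)))"

lemma V01_eigen: "Z \<in> V01 \<Longrightarrow> cmap J Z = cscale (- \<i>) Z"
  by (auto simp: V01_def cmap_def cscale_def J_simps prod_eq_iff)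

lemma pr_sum: "pr10 Z + pr01 Z = Z"
  by (simp add: pr01_def pr10_def prod_eq_iff flip: scaleR_add_left scaleR_add_right)

lemma pr01_add: "pr01 (Z + W) = pr01 Z + pr01 W"
  and pr10_add: "pr10 (Z + W) = pr10 Z + pr10 W"
  and pr01_scale: "pr01 (cscale c Z) = cscale c (pr01 Z)"
  and pr10_scale: "pr10 (cscale c Z) = cscale c (pr10 Z)"
  by (auto simp: pr01_def pr10_def cscale_def prod_eq_iff J_simps algebra_simps)

lemma pr01_cmap: "pr01 (cmap J Z) = cscale (- \<i>) (pr01 Z)"
  and pr10_cmap: "pr10 (cmap J Z) = cscale \<i> (pr10 Z)"
  by (auto simp: pr01_def pr10_def cscale_def cmap_def prod_eq_iff J_simps algebra_simps)

lemma pr01_in_V01: "pr01 Z \<in> V01"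
  by (auto simp: pr01_def V01_def J_simps algebra_simps)

lemma pr01_V01: "Z \<in> V01 \<Longrightarrow> pr01 Z = Z"
  by (auto simp: pr01_def V01_def J_simps prod_eq_iff simp flip: scaleR_add_left scaleR_2)

lemma V01_subspace: "cplx.subspace V01"
  by (rule cplx.subspaceI) (auto simp: V01_def cscale_def J_simps linear_0[OF linear_J])

text \<open>Comparison of eigenvalues: \<open>a (cmap J Z)\<close> equals both
  \<open>\<i> * a Z\<close> and \<open>- \<i> * a Z\<close>.\<close>

lemma dual10_V01: "a \<in> dual_eigenspace J \<i> \<Longrightarrow> Z \<in> V01 \<Longrightarrow> a Z = 0"
proof -
  assume a: "a \<in> dual_eigenspace J \<i>" and Z: "Z \<in> V01"
  have "\<i> * a Z = - \<i> * a Z"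
    using a V01_eigen[OF Z] clinear_form_scale[of a "- \<i>" Z] unfolding dual_eigenspace_def
    by (metis (mono_tags, lifting) mem_Collect_eq)
  then show "a Z = 0"
    by (simp add: eq_neg_iff_add_eq_0)
qed

text \<open>The component \<open>pr10 Z\<close> is an eigenvector for \<open>\<i>\<close>, so
  \<open>b\<close> kills it by comparing eigenvalues again.\<close>

lemma dual01_comp_pr01:
  assumes "b \<in> dual_eigenspace J (- \<i>)"
  shows "b (pr01 Z) = b Z"
proof -
  have b: "clinear_form b" "b (cmap J W) = - \<i> * b W" for W
    using assms by (auto simp: dual_eigenspace_def)
  have "cmap J (pr10 Z) = cscale \<i> (pr10 Z)"
    by (auto simp: pr10_def cscale_def cmap_def prod_eq_iff J_simps algebra_simps)
  then have "\<i> * b (pr10 Z) = - \<i> * b (pr10 Z)"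
    using b(2)[of "pr10 Z"] clinear_form_scale[OF b(1), of \<i> "pr10 Z"] by metis
  then have "b (pr10 Z) = 0"
    by (simp add: eq_neg_iff_add_eq_0)
  then show ?thesis
    using clinear_form_add[OF b(1), of "pr10 Z" "pr01 Z"] by (simp add: pr_sum)
qed

text \<open>Supplies the eigenforms from which forms of degree 2 are assembled later: composing with
  a projection turns any coordinate function into one.\<close>

lemma comp_pr01_dual: "clinear_form \<alpha> \<Longrightarrow> (\<lambda>Z. \<alpha> (pr01 Z)) \<in> dual_eigenspace J (- \<i>)"
  and comp_pr10_dual: "clinear_form \<alpha> \<Longrightarrow> (\<lambda>Z. \<alpha> (pr10 Z)) \<in> dual_eigenspace J \<i>"
  by (auto simp: dual_eigenspace_def clinear_form_iff pr01_add pr10_add pr01_scale pr10_scale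
      pr01_cmap pr10_cmap simp del: cplx.scale_minus_left)

lemma bidegree_forms_length:
  assumes "\<eta> \<in> bidegree_forms J p q" "length Zs \<noteq> p + q"
  shows "\<eta> Zs = 0"
  using assms(1) unfolding bidegree_forms_def
  by (induction rule: cform.span_induct_alt) (use assms(2) in \<open>auto simp: wedge_def\<close>)

text \<open>Every factor of a generator ignores the \<open>pr10\<close> component of its argument;
  hence the values on \<open>V01\<close> determine the form.\<close>

lemma bidegree_forms_0q_pr01:
  assumes "\<beta> \<in> bidegree_forms J 0 q"
  shows "\<beta> (map pr01 Zs) = \<beta> Zs"
  using assms unfolding bidegree_forms_def
proof (induction rule: cform.span_induct_alt)
  case (step c x y)
  then obtain bs where bs: "x = wedge bs" "set bs \<subseteq> dual_eigenspace J (- \<i>)"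
    by auto
  have "wedge bs (map pr01 Zs) = wedge bs Zs"
  proof (cases "length Zs = length bs")
    case True
    have "(bs ! i) (map pr01 Zs ! \<sigma> i) = (bs ! i) (Zs ! \<sigma> i)"
      if "\<sigma> permutes {..<length bs}" "i < length bs" for \<sigma> i
    proof -
      have "\<sigma> i < length Zs"
        using permutes_in_image[OF that(1), of i] that(2) True by auto
      moreover have "bs ! i \<in> dual_eigenspace J (- \<i>)"
        using bs(2) that(2) by auto
      ultimately show ?thesis
        by (simp add: dual01_comp_pr01)
    qed
    then show ?thesis
      by (simp add: wedge_def)
  qed (simp add: wedge_def)
  then show ?case
    using step bs by simp
qed simp

lemma bidegree_forms_other_V01:
  assumes "\<eta> \<in> bidegree_forms J r s" "(r, s) \<noteq> (0, q)" "length Zs = q" "set Zs \<subseteq> V01"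
  shows "\<eta> Zs = 0"
  using assms(1) unfolding bidegree_forms_def
proof (induction rule: cform.span_induct_alt)
  case (step c x y)
  then obtain as bs where x: "x = wedge (as @ bs)" "length as = r" "length bs = s"
    "set as \<subseteq> dual_eigenspace J \<i>"
    by auto
  have "wedge (as @ bs) Zs = 0"
  proof (cases "length Zs = length (as @ bs)")
    case True
    \<comment> \<open>The degrees agree, so \<open>r = 0\<close> would give \<open>s = q\<close>,
      which is excluded. Thus a factor of type (1,0) stands in front and kills every term of the
      determinant.\<close>
    then have r: "r \<noteq> 0"
      using assms(2,3) x by auto
    have "\<exists>i<length (as @ bs). ((as @ bs) ! i) (Zs ! \<sigma> i) = 0"
      if "\<sigma> permutes {..<length (as @ bs)}" for \<sigma>
    proof -
      have "\<sigma> 0 < length Zs"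
        using permutes_in_image[OF that, of 0] r x True by auto
      then have "Zs ! \<sigma> 0 \<in> V01"
        using assms(4) by auto
      moreover have "(as @ bs) ! 0 \<in> dual_eigenspace J \<i>"
        using x r by (auto simp: nth_append)
      ultimately show ?thesis
        using r x dual10_V01 by (intro exI[of _ 0]) auto
    qed
    then have "of_int (sign \<sigma>) * (\<Prod>i<length (as @ bs). ((as @ bs) ! i) (Zs ! \<sigma> i)) = (0 :: complex)"
      if "\<sigma> permutes {..<length (as @ bs)}" for \<sigma>
      using that by (simp add: prod_zero_iff) fastforce
    then show ?thesis
      unfolding wedge_def by (simp add: sum.neutral)
  qed (simp add: wedge_def)
  then show ?case
    using step x by simp
qed simp

text \<open>A form of bidegree \<open>(0, q)\<close> is determined by its values on \<open>V01\<close>, where all forms of other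
  bidegrees vanish; this makes the component of bidegree \<open>(0, q)\<close> unique.\<close>

lemma bidegree_part_0q:
  assumes \<beta>: "\<beta> \<in> bidegree_forms J 0 q"
    and rest: "\<eta> - \<beta> \<in> cform_span (\<Union>{bidegree_forms J r s | r s. (r, s) \<noteq> (0, q)})"
  shows "bidegree_part J 0 q \<eta> = \<beta>"
  unfolding bidegree_part_def
proof (rule the_equality)
  show "\<beta> \<in> bidegree_forms J 0 q \<and>
    \<eta> - \<beta> \<in> cform_span (\<Union>{bidegree_forms J r s | r s. (r, s) \<noteq> (0, q)})"
    using assms by blast
next
  fix \<gamma>
  assume \<gamma>: "\<gamma> \<in> bidegree_forms J 0 q \<and>
    \<eta> - \<gamma> \<in> cform_span (\<Union>{bidegree_forms J r s | r s. (r, s) \<noteq> (0, q)})"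
  have vanish: "\<theta> Zs = 0"
    if "\<theta> \<in> cform_span (\<Union>{bidegree_forms J r s | r s. (r, s) \<noteq> (0, q)})"
      "length Zs = q" "set Zs \<subseteq> V01" for \<theta> Zs
    using that(1)
  proof (induction rule: cform.span_induct_alt)
    case (step c x y)
    then show ?case
      using bidegree_forms_other_V01[OF _ _ that(2,3)] by auto
  qed simp
  show "\<gamma> = \<beta>"
  proof
    fix Zs
    show "\<gamma> Zs = \<beta> Zs"
    proof (cases "length Zs = q")
      case True
      have "set (map pr01 Zs) \<subseteq> V01"
        by (auto simp: pr01_in_V01)
      then have "(\<eta> - \<beta>) (map pr01 Zs) = 0" "(\<eta> - \<gamma>) (map pr01 Zs) = 0"
        using vanish[OF rest, of "map pr01 Zs"] vanish[OF conjunct2[OF \<gamma>], of "map pr01 Zs"] True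
        by (simp_all only: length_map)
      then have "\<gamma> (map pr01 Zs) = \<beta> (map pr01 Zs)"
        by simp
      then show ?thesis
        using bidegree_forms_0q_pr01 \<beta> \<gamma> by metis
    next
      case False
      then show ?thesis
        using bidegree_forms_length[of \<beta> 0 q] bidegree_forms_length[of \<gamma> 0 q] \<beta> \<gamma> by simp
    qed
  qed
qed

text \<open>The generators already form a subspace, so taking the span adds nothing.\<close>

lemma bidegree_forms_01:
  "bidegree_forms J 0 1 = {wedge [b] | b. b \<in> dual_eigenspace J (- \<i>)}"
proof -
  have eq: "{wedge (as @ bs) | as bs. length as = 0 \<and> set as \<subseteq> dual_eigenspace J \<i> \<and>
      length bs = 1 \<and> set bs \<subseteq> dual_eigenspace J (- \<i>)}
    = {wedge [b] | b. b \<in> dual_eigenspace J (- \<i>)}" (is "_ = ?S")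
    by (fastforce simp: length_Suc_conv)
  have "cform.subspace ?S"
  proof (rule cform.subspaceI)
    have "(\<lambda>_. 0) \<in> dual_eigenspace J (- \<i>)"
      by (auto simp: dual_eigenspace_def clinear_form_iff)
    then show "0 \<in> ?S"
      by (auto simp: wedge_singleton fun_eq_iff)
  next
    fix x y assume "x \<in> ?S" "y \<in> ?S"
    then obtain a b where ab: "a \<in> dual_eigenspace J (- \<i>)" "b \<in> dual_eigenspace J (- \<i>)"
      "x = wedge [a]" "y = wedge [b]" by auto
    then have "(\<lambda>Z. a Z + b Z) \<in> dual_eigenspace J (- \<i>)"
      by (auto simp: dual_eigenspace_def clinear_form_iff algebra_simps)
    moreover have "x + y = wedge [\<lambda>Z. a Z + b Z]"
      by (auto simp: ab wedge_singleton fun_eq_iff)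
    ultimately show "x + y \<in> ?S" by blast
  next
    fix c x assume "x \<in> ?S"
    then obtain a where ab: "a \<in> dual_eigenspace J (- \<i>)" "x = wedge [a]" by auto
    then have "(\<lambda>Z. c * a Z) \<in> dual_eigenspace J (- \<i>)"
      by (auto simp: dual_eigenspace_def clinear_form_iff algebra_simps)
    moreover have "(\<lambda>Zs. c * x Zs) = wedge [\<lambda>Z. c * a Z]"
      by (auto simp: ab wedge_singleton fun_eq_iff)
    ultimately show "(\<lambda>Zs. c * x Zs) \<in> ?S" by blast
  qed
  then show ?thesis
    unfolding bidegree_forms_def eq by (simp add: cform.span_eq_iff)
qed

end

section \<open>Finite complex bases and the dimension of a space modulo zero\<close>

lemma finite_cplx_basis:
  fixes S :: "'g::real_vector set"
  assumes "finite S" "span S = UNIV"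
  obtains C :: "'g complexification set"
  where "finite C" "cplx.independent C" "cplx.span C = UNIV"
proof -
  let ?T = "(\<lambda>v. (v, 0)) ` S"
  have real: "(X, 0) \<in> cplx.span ?T" for X
  proof -
    have "X \<in> span S"
      using assms by simp
    then show ?thesis
    proof (induction rule: span_induct_alt)
      case base
      then show ?case
        using cplx.span_zero[of ?T] by (simp add: zero_prod_def)
    next
      case (step c x y)
      then have "cscale (of_real c) (x, 0) + (y, 0) \<in> cplx.span ?T"
        by (auto intro!: cplx.span_add cplx.span_scale intro: cplx.span_base)
      moreover have "cscale (of_real c) (x, 0) + (y, 0) = (c *\<^sub>R x + y, 0)"
        by (simp add: cscale_def)
      ultimately show ?case
        by simp
    qed
  qed
  \<comment> \<open>Since \<open>X + \<i> Y\<close> is a complex combination of real vectors, a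
    finite real spanning set also spans over the complex numbers and bounds the size of every
    independent set.\<close>
  have "Z \<in> cplx.span ?T" for Z
  proof -
    have "(fst Z, 0) + cscale \<i> (snd Z, 0) \<in> cplx.span ?T"
      by (intro cplx.span_add cplx.span_scale real)
    moreover have "(fst Z, 0) + cscale \<i> (snd Z, 0) = Z"
      by (simp add: cscale_def)
    ultimately show ?thesis
      by simp
  qed
  then have T: "cplx.span ?T = UNIV"
    by blast
  obtain C :: "'g complexification set" where C: "cplx.independent C" "UNIV \<subseteq> cplx.span C"
    using cplx.basis_exists by metis
  then have "finite C"
    using cplx.independent_span_bound[of ?T C] assms(1) T by blast
  with C that show thesis
    by blast
qed

text \<open>Turns the coefficient conditions of \<open>quotient_basis\<close> into independence and
  span, to which the exchange bound applies.\<close>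

lemma quotient_basis_zeroD:
  assumes "quotient_basis V {0} B"
  shows "finite B" "B \<subseteq> V" "cform.independent B" "V \<subseteq> cform_span B"
proof -
  show fin: "finite B" and "B \<subseteq> V"
    using assms by (auto simp: quotient_basis_def)
  show "cform.independent B"
    using assms by (auto simp: cform.dependent_finite[OF fin] sum_fun_eq quotient_basis_def)
  show "V \<subseteq> cform_span B"
  proof
    fix v assume "v \<in> V"
    then obtain c where "v = (\<lambda>x. \<Sum>b\<in>B. c b * b x)"
      using assms by (auto simp: quotient_basis_def)
    moreover have "(\<Sum>b\<in>B. (\<lambda>x. c b * b x)) \<in> cform_span B"
      by (intro cform.span_sum cform.span_scale cform.span_base)
    ultimately show "v \<in> cform_span B"
      by (simp add: sum_fun_eq)
  qed
qed

text \<open>Two bases of the same space have equal size by the exchange bound, so the definite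
  description in \<open>quotient_dim\<close> is well defined.\<close>

lemma quotient_dim_zero_eqI:
  assumes "quotient_basis V {0} B"
  shows "quotient_dim V {0} = card B"
  unfolding quotient_dim_def
proof (rule the_equality)
  fix n assume "\<exists>B. quotient_basis V {0} B \<and> card B = n"
  then obtain B' where B': "quotient_basis V {0} B'" "card B' = n"
    by blast
  note b = quotient_basis_zeroD[OF assms] and b' = quotient_basis_zeroD[OF B'(1)]
  have "card B \<le> card B'" "card B' \<le> card B"
    using cform.independent_span_bound[of B B'] cform.independent_span_bound[of B' B] b b' by auto
  with B' show "n = card B"
    by simp
qed (use assms in blast)

section \<open>The differential in low degree and its (0,2) component\<close>

lemma ce_differential_1form:
  "ce_differential br (wedge [\<alpha>]) Zs =
    (if length Zs = 2 then - \<alpha> (cbracket br (Zs ! 0) (Zs ! 1)) else 0)"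
proof (cases "length Zs = 2")
  case True
  then obtain Z W where "Zs = [Z, W]"
    by (auto simp: numeral_2_eq_2 length_Suc_conv)
  moreover have "{..<Suc (Suc 0)} = {0, 1}" "{..<Suc 0} = {0}"
    by auto
  ultimately show ?thesis
    by (simp add: ce_differential_def wedge_singleton nths_Cons)
next
  case False
  \<comment> \<open>If \<open>length Zs\<close> is not 2, the bracket is followed by at least one
    more argument, so \<open>wedge [\<alpha>]\<close> meets a list of length other than 1 and takes
    its default value 0.\<close>
  have "length (nths Zs (- {i, j})) \<noteq> 0" if "j < length Zs" "i < j" for i j
  proof -
    have "{k. k < length Zs \<and> k \<in> - {i, j}} = {..<length Zs} - {i, j}"
      by auto
    then have "length (nths Zs (- {i, j})) = length Zs - 2"
      using that by (simp add: length_nths card_Diff_subset)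
    then show ?thesis
      using that False by simp
  qed
  then show ?thesis
    using False by (simp add: ce_differential_def wedge_singleton)
qed

context almost_complex
begin

text \<open>Expanding an alternating bilinear form in coordinates splits it by the types of its two
  arguments. The part that sees only \<open>pr01\<close> has type (0,2); the rest is a combination
  of types (2,0) and (1,1).\<close>

lemma bidegree_part_02:
  fixes C :: "'g complexification set"
  assumes C: "finite C" "cplx.independent C" "cplx.span C = UNIV"
    and lin: "\<And>Z. clinear_form (A Z)" and alt: "\<And>Z W. A W Z = - A Z W"
  shows "bidegree_part J 0 2 (\<lambda>Zs. if length Zs = 2 then A (Zs ! 0) (Zs ! 1) else 0) =
    (\<lambda>Zs. if length Zs = 2 then A (pr01 (Zs ! 0)) (pr01 (Zs ! 1)) else 0)"
    (is "bidegree_part J 0 2 ?\<eta> = ?\<beta>")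
proof (rule bidegree_part_0q)
  let ?r = "cplx.representation C"
  define a where "a k = (\<lambda>Z. ?r (pr10 Z) k)" for k
  define b where "b k = (\<lambda>Z. ?r (pr01 Z) k)" for k
  have rep: "clinear_form (\<lambda>Z. ?r Z k)" for k
    using C by (simp add: clinear_form_iff cplx.representation_add cplx.representation_scale)
  have ab: "a k \<in> dual_eigenspace J \<i>" "b k \<in> dual_eigenspace J (- \<i>)" for k
    unfolding a_def b_def by (rule comp_pr10_dual[OF rep] comp_pr01_dual[OF rep])+
  define F where "F x y = (\<Sum>k\<in>C. \<Sum>l\<in>C. A k l * (x k * y l))" for x y :: "_ \<Rightarrow> complex"
  have lin2: "clinear_form (\<lambda>Z. A Z W)" for W
    using lin[of W] alt unfolding clinear_form_iff by (metis minus_add_distrib mult_minus_right)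
  have exp: "A Z W = F (?r Z) (?r W)" for Z W
  proof -
    have dec: "Y = (\<Sum>k\<in>C. cscale (?r Y k) k)" for Y
      using cplx.sum_representation_eq[of C Y C] C by simp
    have right: "A k W = (\<Sum>l\<in>C. ?r W l * A k l)" for k
      by (subst dec[of W]) (simp add: clinear_form_sum[OF lin] clinear_form_scale[OF lin])
    have "A Z W = (\<Sum>k\<in>C. ?r Z k * A k W)"
      by (subst dec[of Z]) (simp add: clinear_form_sum[OF lin2] clinear_form_scale[OF lin2])
    also have "\<dots> = (\<Sum>k\<in>C. ?r Z k * (\<Sum>l\<in>C. ?r W l * A k l))"
      by (subst right) (rule refl)
    finally show ?thesis
      by (simp add: F_def sum_distrib_left mult_ac)
  qed
  \<comment> \<open>The sum runs over all ordered pairs, so each wedge is counted twice; hence the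
    factor 1/2.\<close>
  have \<beta>: "?\<beta> = (\<Sum>k\<in>C. \<Sum>l\<in>C. (\<lambda>Zs. (A k l / 2) * wedge [b k, b l] Zs))"
  proof
    fix Zs
    have "(\<Sum>k\<in>C. \<Sum>l\<in>C. (A k l / 2) * (b k Z * b l W - b k W * b l Z)) =
      (F (?r (pr01 Z)) (?r (pr01 W)) - F (?r (pr01 W)) (?r (pr01 Z))) / 2" for Z W
      by (simp add: F_def b_def algebra_simps sum_subtractf sum_divide_distrib diff_divide_distrib)
    also have "\<dots> Z W = A (pr01 Z) (pr01 W)" for Z W
      using alt[of "pr01 W" "pr01 Z"] by (simp flip: exp)
    finally show "?\<beta> Zs = (\<Sum>k\<in>C. \<Sum>l\<in>C. (\<lambda>Zs. (A k l / 2) * wedge [b k, b l] Zs)) Zs"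
      by (simp add: sum_fun_apply wedge_pair)
  qed
  have mem: "wedge [x, y] \<in> bidegree_forms J p q"
    if "[x, y] = as @ bs" "length as = p" "set as \<subseteq> dual_eigenspace J \<i>"
      "length bs = q" "set bs \<subseteq> dual_eigenspace J (- \<i>)" for x y as bs p q
    unfolding bidegree_forms_def using that by (intro cform.span_base) auto
  show "?\<beta> \<in> bidegree_forms J 0 2"
    unfolding \<beta>
  proof -
    have "wedge [b k, b l] \<in> bidegree_forms J 0 2" for k l
      by (rule mem[of _ _ "[]" "[b k, b l]"]) (auto simp: ab)
    then show "(\<Sum>k\<in>C. \<Sum>l\<in>C. (\<lambda>Zs. (A k l / 2) * wedge [b k, b l] Zs)) \<in> bidegree_forms J 0 2"
      unfolding bidegree_forms_def by (intro cform.span_sum cform.span_scale)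
  qed
  \<comment> \<open>The mixed terms \<open>b k\<close> wedge \<open>a l\<close> are written as minus
    \<open>a l\<close> wedge \<open>b k\<close>, because generators of type (1,1) list the (1,0)
    factor first.\<close>
  have diff: "?\<eta> - ?\<beta> = (\<Sum>k\<in>C. \<Sum>l\<in>C. (\<lambda>Zs. (A k l / 2) *
      (wedge [a k, a l] + wedge [a k, b l] - wedge [a l, b k]) Zs))"
  proof
    fix Zs
    have "(\<Sum>k\<in>C. \<Sum>l\<in>C. (A k l / 2) * ((a k Z * a l W - a k W * a l Z) +
        (a k Z * b l W - a k W * b l Z) - (a l Z * b k W - a l W * b k Z))) =
      (A (pr10 Z) (pr10 W) - A (pr10 W) (pr10 Z) + A (pr10 Z) (pr01 W) - A (pr10 W) (pr01 Z)
        - A (pr01 W) (pr10 Z) + A (pr01 Z) (pr10 W)) / 2" for Z W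
      unfolding exp[of "pr10 _"] exp[of "pr01 _"]
      by (simp add: F_def a_def b_def algebra_simps sum_subtractf sum.distrib
          sum_divide_distrib diff_divide_distrib add_divide_distrib)
    also have "\<dots> Z W = A (pr10 Z + pr01 Z) (pr10 W + pr01 W) - A (pr01 Z) (pr01 W)" for Z W
      unfolding clinear_form_add[OF lin] clinear_form_add[OF lin2]
      using alt[of "pr10 W" "pr10 Z"] alt[of "pr10 W" "pr01 Z"] alt[of "pr01 W" "pr10 Z"]
      by (simp add: field_simps)
    finally show "(?\<eta> - ?\<beta>) Zs = (\<Sum>k\<in>C. \<Sum>l\<in>C. (\<lambda>Zs. (A k l / 2) *
        (wedge [a k, a l] + wedge [a k, b l] - wedge [a l, b k]) Zs)) Zs"
      by (simp add: sum_fun_apply wedge_pair pr_sum)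
  qed
  let ?S = "\<Union>{bidegree_forms J r s | r s. (r, s) \<noteq> (0, 2)}"
  have sub: "bidegree_forms J p q \<subseteq> ?S" if "(p, q) \<noteq> (0, 2)" for p q
    using that by (intro Union_upper CollectI exI conjI) (rule refl)
  have "wedge [a k, a l] \<in> ?S" for k l
    by (rule subsetD[OF sub[of 2 0] mem[of _ _ "[a k, a l]" "[]"]]) (auto simp: ab)
  moreover have "wedge [a k, b l] \<in> ?S" for k l
    by (rule subsetD[OF sub[of 1 1] mem[of _ _ "[a k]" "[b l]"]]) (auto simp: ab)
  ultimately have "(\<Sum>k\<in>C. \<Sum>l\<in>C. (\<lambda>Zs. (A k l / 2) *
      (wedge [a k, a l] + wedge [a k, b l] - wedge [a l, b k]) Zs)) \<in> cform_span ?S"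
    by (intro cform.span_sum cform.span_scale cform.span_add cform.span_diff cform.span_base)
  then show "?\<eta> - ?\<beta> \<in> cform_span ?S"
    unfolding diff .
qed

text \<open>A form of degree 0 is supported on the empty list, while the differential evaluates it
  only on lists headed by a bracket.\<close>

lemma dolbeault_coboundaries_01: "dolbeault_coboundaries br J 0 1 = {0}"
proof -
  have "delbar br J 0 0 \<alpha> = 0" if "\<alpha> \<in> bidegree_forms J 0 0" for \<alpha>
  proof -
    have "ce_differential br \<alpha> = 0"
      using bidegree_forms_length[OF that] by (auto simp: ce_differential_def)
    then show ?thesis
      unfolding delbar_def
      by (intro bidegree_part_0q) (auto simp: cform.span_zero bidegree_forms_def)
  qed
  moreover have "0 \<in> bidegree_forms J 0 0"
    by (auto simp: cform.span_zero bidegree_forms_def)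
  ultimately show ?thesis
    by (auto simp: dolbeault_coboundaries_def)
qed

end

section \<open>The complexified bracket and nilpotency\<close>

lemma cbracket_bilinear:
  assumes "bilinear br"
  shows "cbracket br (Z + Z') W = cbracket br Z W + cbracket br Z' W"
    and "cbracket br Z (W + W') = cbracket br Z W + cbracket br Z W'"
    and "cbracket br (cscale c Z) W = cscale c (cbracket br Z W)"
    and "cbracket br Z (cscale c W) = cscale c (cbracket br Z W)"
  using assms
  by (simp_all add: cbracket_def cscale_def prod_eq_iff bilinear_ladd bilinear_radd bilinear_lsub
      bilinear_rsub bilinear_lmul bilinear_rmul algebra_simps)

lemma lie_bracket_anti:
  assumes "lie_algebra br"
  shows "br X Y = - br Y X"
proof -
  have bil: "bilinear br" and self: "br X X = 0" for X
    using assms by (auto simp: lie_algebra_def)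
  have "br (X + Y) (X + Y) = br X Y + br Y X"
    by (simp only: bilinear_ladd[OF bil] bilinear_radd[OF bil]) (simp add: self)
  then show ?thesis
    by (simp add: self eq_neg_iff_add_eq_0)
qed

lemma cbracket_anti:
  assumes "lie_algebra br"
  shows "cbracket br Z W = - cbracket br W Z"
  using lie_bracket_anti[OF assms, of "fst Z" "fst W"] lie_bracket_anti[OF assms, of "snd Z" "snd W"]
    lie_bracket_anti[OF assms, of "fst Z" "snd W"] lie_bracket_anti[OF assms, of "snd Z" "fst W"]
  by (simp add: cbracket_def)

lemma lower_central_subspace: "subspace (lower_central br n)"
  by (cases n) (simp_all add: subspace_span)

lemma lower_central_bracket: "Y \<in> lower_central br n \<Longrightarrow> br X Y \<in> lower_central br (Suc n)"
  by (auto intro: span_base)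

text \<open>The last nonzero term of the lower central series is central.\<close>

lemma nilpotent_center_nonzero:
  fixes br :: "'g::real_vector \<Rightarrow> 'g \<Rightarrow> 'g"
  assumes "lower_central br n = {0}" "(UNIV :: 'g set) \<noteq> {0}"
  shows "\<exists>Y. Y \<noteq> 0 \<and> (\<forall>X. br X Y = 0)"
proof -
  define m where "m = (LEAST n. lower_central br n = {0})"
  have m: "lower_central br m = {0}"
    unfolding m_def using assms(1) by (rule LeastI)
  \<comment> \<open>The term of index 0 is the whole space, which is not \<open>{0}\<close>, so the
    first vanishing index has a predecessor.\<close>
  obtain k where k: "m = Suc k"
    using m assms(2) by (cases m) auto
  then have "lower_central br k \<noteq> {0}"
    using not_less_Least[of k "\<lambda>n. lower_central br n = {0}"] by (simp add: m_def)
  moreover have "0 \<in> lower_central br k"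
    by (simp add: lower_central_subspace subspace_0)
  ultimately obtain Y where "Y \<in> lower_central br k" "Y \<noteq> 0"
    by blast
  moreover from this have "br X Y = 0" for X
    using lower_central_bracket[of Y br k X] k m by simp
  ultimately show ?thesis
    by blast
qed

text \<open>With \<open>D\<close> the span of \<open>[U, U]\<close>, the inclusion \<open>U \<subseteq> \<complex>e + D\<close> gives \<open>[U, U] \<subseteq> [e, D] + [U, D]\<close>,
  so by induction \<open>[U, U]\<close> lies in every term of the lower central series.\<close>

lemma nilpotent_codim1_bracket_zero:
  fixes br :: "'g::real_vector \<Rightarrow> 'g \<Rightarrow> 'g"
  assumes lie: "lie_algebra br" and nil: "lower_central br n = {0}"
    and U: "U \<subseteq> cplx.span (insert e (cplx.span {cbracket br Z W | Z W. Z \<in> U \<and> W \<in> U}))"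
    and "Z \<in> U" "W \<in> U"
  shows "cbracket br Z W = 0"
proof -
  let ?D = "cplx.span {cbracket br Z W | Z W. Z \<in> U \<and> W \<in> U}"
  \<comment> \<open>The complexified lower central series.\<close>
  define L where "L k = {Z. fst Z \<in> lower_central br k \<and> snd Z \<in> lower_central br k}" for k
  note cbil = cbracket_bilinear[OF lie_algebra_def[THEN iffD1, OF lie, THEN conjunct1]]
  note canti = cbracket_anti[OF lie]
  have calt: "cbracket br e e = 0"
    using lie lie_bracket_anti[OF lie, of "snd e" "fst e"]
    by (simp add: cbracket_def lie_algebra_def zero_prod_def)
  have L: "cplx.subspace (L k)" for k
    using lower_central_subspace[of br k]
    by (intro cplx.subspaceI)
      (auto simp: L_def cscale_def subspace_0 subspace_add subspace_scale subspace_diff)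
  have brL: "cbracket br Z W \<in> L (Suc k)" if "W \<in> L k" for Z W k
    using that lower_central_bracket[of _ br k] lower_central_subspace[of br "Suc k"]
    unfolding L_def cbracket_def
    by (auto simp del: lower_central.simps intro: subspace_diff subspace_add)
  have "cbracket br Z W \<in> L k" if "Z \<in> U" "W \<in> U" for Z W k
    using that
  proof (induction k arbitrary: Z W)
    case 0
    then show ?case
      by (simp add: L_def)
  next
    case (Suc k)
    then have D: "?D \<subseteq> L k"
      by (intro cplx.span_minimal L) auto
    have "\<exists>c. Y - cscale c e \<in> ?D" if "Y \<in> U" for Y
      using subsetD[OF U that] unfolding cplx.span_breakdown_eq cplx.span_span .
    with Suc.prems obtain z w where d: "Z - cscale z e \<in> ?D" "W - cscale w e \<in> ?D"
      by blast
    define Z' where "Z' = Z - cscale z e"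
    define W' where "W' = W - cscale w e"
    have ZW: "Z = cscale z e + Z'" "W = cscale w e + W'"
      by (simp_all add: Z'_def W'_def)
    \<comment> \<open>As \<open>[e, e] = 0\<close>, only \<open>Z'\<close> survives in
      \<open>[Z, e]\<close>; flipping that bracket puts an element of \<open>?D\<close> into the
      second slot of both terms, as \<open>brL\<close> requires.\<close>
    have "cbracket br Z W = cbracket br Z W' + cscale w (cbracket br Z e)"
      by (subst ZW(2)) (simp add: cbil)
    also have "cbracket br Z e = - cbracket br e Z'"
      using canti[of Z' e] by (subst ZW(1)) (simp add: cbil calt)
    finally have eq: "cbracket br Z W = cbracket br Z W' + cscale w (- cbracket br e Z')" .
    have "cbracket br Z W' \<in> L (Suc k)" "cbracket br e Z' \<in> L (Suc k)"
      using d D by (auto intro!: brL simp: Z'_def W'_def)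
    then show ?case
      unfolding eq using L by (intro cplx.subspace_add cplx.subspace_scale cplx.subspace_neg)
  qed
  from this[of Z W n] show ?thesis
    using assms(4,5) nil by (simp add: L_def prod_eq_iff)
qed

section \<open>Bound on the complex dimension of \<open>V01\<close> by half the real
  dimension\<close>

context almost_complex
begin

text \<open>\<open>fst\<close> identifies \<open>V01\<close> with the real space, multiplication by
  \<open>-\<i>\<close> becoming \<open>J\<close>. So a complex independent set yields twice as many
  real independent vectors, namely \<open>fst Z\<close> and \<open>J (fst Z)\<close>.\<close>

lemma V01_independent_card:
  assumes S: "finite S" "span S = (UNIV :: 'g set)"
    and B: "finite B" "cplx.independent B" "B \<subseteq> V01"
  shows "2 * card B \<le> card S"
proof -
  have combination: "(\<forall>Z\<in>B. u Z = 0 \<and> v Z = 0)"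
    if "(\<Sum>Z\<in>B. u Z *\<^sub>R fst Z) + (\<Sum>Z\<in>B. v Z *\<^sub>R J (fst Z)) = 0" for u v
  proof -
    \<comment> \<open>A real relation with coefficients \<open>u\<close> and \<open>v\<close> is the
      first component of a complex one with coefficients \<open>u - \<i> v\<close>; the second
      component is its image under \<open>J\<close>.\<close>
    let ?c = "\<lambda>Z. Complex (u Z) (- v Z)"
    have "(\<Sum>Z\<in>B. cscale (?c Z) Z) = (\<Sum>Z\<in>B. (u Z *\<^sub>R fst Z + v Z *\<^sub>R J (fst Z),
        J (u Z *\<^sub>R fst Z + v Z *\<^sub>R J (fst Z))))"
      using B(3) by (intro sum.cong) (auto simp: cscale_def V01_def J_simps)
    also have "\<dots> = 0"
      using that
      by (simp add: prod_eq_iff fst_sum snd_sum sum.distrib flip: linear_sum[OF linear_J])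
        (simp add: linear_0[OF linear_J])
    finally have "?c Z = 0" if "Z \<in> B" for Z
      by (rule cplx.independentD[OF B(2,1) subset_refl _ that])
    then show ?thesis
      by (simp add: complex_eq_iff)
  qed
  define f where "f p = (if snd p then fst (fst p) else J (fst (fst p)))"
    for p :: "'g complexification \<times> bool"
  have UB: "B \<times> UNIV = (\<lambda>Z. (Z, True)) ` B \<union> (\<lambda>Z. (Z, False)) ` B"
    by auto
  have sum_UB: "(\<Sum>p\<in>B \<times> UNIV. g p *\<^sub>R f p) =
      (\<Sum>Z\<in>B. g (Z, True) *\<^sub>R fst Z) + (\<Sum>Z\<in>B. g (Z, False) *\<^sub>R J (fst Z))" for g
    unfolding UB using B(1)
    by (subst sum.union_disjoint) (auto simp: sum.reindex inj_on_def f_def)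
  have zero: "g p = 0" if "(\<Sum>p\<in>B \<times> UNIV. g p *\<^sub>R f p) = 0" "p \<in> B \<times> UNIV" for g p
  proof -
    have "\<forall>Z\<in>B. g (Z, True) = 0 \<and> g (Z, False) = 0"
      by (rule combination) (use that(1) sum_UB[of g] in simp)
    then have "g (Z, c) = 0" if "Z \<in> B" for Z c
      using that by (cases c) auto
    then show ?thesis
      using that(2) by (metis mem_Times_iff prod.collapse)
  qed
  have fin: "finite (B \<times> (UNIV :: bool set))"
    using B(1) by simp
  have inj: "inj_on f (B \<times> UNIV)"
  proof (rule inj_onI, rule ccontr)
    fix p q assume pq: "p \<in> B \<times> UNIV" "q \<in> B \<times> UNIV" "f p = f q" "p \<noteq> q"
    \<comment> \<open>A coincidence \<open>f p = f q\<close> is a relation with coefficients 1 at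
      \<open>p\<close> and -1 at \<open>q\<close>. Excluding it ensures that the image really has
      \<open>2 * card B\<close> elements.\<close>
    let ?g = "\<lambda>r. (if r = p then 1 else 0) - (if r = q then 1 else 0) :: real"
    have "(\<Sum>r\<in>B \<times> UNIV. ?g r *\<^sub>R f r) =
        (\<Sum>r\<in>B \<times> UNIV. (if r = p then f p else 0) - (if r = q then f q else 0))"
      by (intro sum.cong) auto
    also have "\<dots> = f p - f q"
      using pq(1,2) fin by (simp add: sum_subtractf)
    finally have "(\<Sum>r\<in>B \<times> UNIV. ?g r *\<^sub>R f r) = 0"
      using pq(3) by simp
    from zero[OF this pq(1)] pq(4) show False
      by simp
  qed
  have "independent (f ` (B \<times> UNIV))"
    using zero[of "u \<circ> f" for u] fin
    by (auto simp: real_vector.dependent_finite sum.reindex[OF inj] simp flip: o_def)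
  then have "card (f ` (B \<times> UNIV)) \<le> card S"
    using real_vector.independent_span_bound[OF S(1)] S(2) by blast
  then show ?thesis
    by (simp add: card_image[OF inj] card_cartesian_product)
qed

end

section \<open>Cohomology in bidegree (0,1) as the dual of \<open>V01/[V01, V01]\<close>\<close>

locale lie_complex_structure =
  fixes br :: "'g::real_vector \<Rightarrow> 'g \<Rightarrow> 'g" and J :: "'g \<Rightarrow> 'g"
  assumes lie: "lie_algebra br" and complex_structure: "complex_structure br J"
begin

sublocale almost_complex J
  using complex_structure by (intro almost_complex.intro) (auto simp: complex_structure_def)

lemma bilinear_br: "bilinear br"
  using lie by (simp add: lie_algebra_def)

text \<open>For \<open>Z = X + \<i> J X\<close> and \<open>W = Y + \<i> J Y\<close> the bracket has
  real part \<open>[X, Y] - [JX, JY]\<close> and imaginary part \<open>[X, JY] + [JX, Y]\<close>;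
  integrability says exactly that \<open>J\<close> maps the former to the latter.\<close>

lemma V01_bracket_closed: "Z \<in> V01 \<Longrightarrow> W \<in> V01 \<Longrightarrow> cbracket br Z W \<in> V01"
proof -
  assume ZW: "Z \<in> V01" "W \<in> V01"
  have "br X Y + J (br (J X) Y) + J (br X (J Y)) - br (J X) (J Y) = 0" for X Y
    using complex_structure by (auto simp: complex_structure_def)
  then have "br X Y - br (J X) (J Y) = - J (br X (J Y) + br (J X) Y)" for X Y
    by (simp add: J_simps algebra_simps eq_neg_iff_add_eq_0)
  then have "J (br X Y - br (J X) (J Y)) = br X (J Y) + br (J X) Y" for X Y
    by (simp only: J_neg J_J minus_minus)
  with ZW show ?thesis
    by (simp add: V01_def cbracket_def)
qed

text \<open>The (0,2) component of the differential of \<open>b\<close> evaluates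
  \<open>- b [Z, W]\<close> after projecting both arguments by \<open>pr01\<close>, whose image is
  \<open>V01\<close>.\<close>

lemma cocycles_01:
  assumes "finite S" "span S = (UNIV :: 'g set)"
  shows "dolbeault_cocycles br J 0 1 = {wedge [b] | b. b \<in> dual_eigenspace J (- \<i>) \<and>
    (\<forall>Z\<in>V01. \<forall>W\<in>V01. b (cbracket br Z W) = 0)}"
proof -
  obtain C :: "'g complexification set"
    where C: "finite C" "cplx.independent C" "cplx.span C = UNIV"
    using finite_cplx_basis[OF assms] .
  have "delbar br J 0 1 (wedge [b]) = 0 \<longleftrightarrow> (\<forall>Z\<in>V01. \<forall>W\<in>V01. b (cbracket br Z W) = 0)"
    if "b \<in> dual_eigenspace J (- \<i>)" for b
  proof -
    have b: "clinear_form b"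
      using that by (simp add: dual_eigenspace_def)
    define A where "A Z W = - b (cbracket br Z W)" for Z W
    have lin: "clinear_form (A Z)" for Z
      using b by (simp add: A_def clinear_form_iff cbracket_bilinear[OF bilinear_br])
    have "cbracket br Z W = cscale (- 1) (cbracket br W Z)" for Z W
      using cbracket_anti[OF lie, of Z W] by simp
    then have alt: "A W Z = - A Z W" for Z W
      unfolding A_def by (metis clinear_form_scale[OF b] mult_minus1)
    have "ce_differential br (wedge [b]) = (\<lambda>Zs. if length Zs = 2 then A (Zs ! 0) (Zs ! 1) else 0)"
      by (auto simp: ce_differential_1form A_def)
    then have "delbar br J 0 1 (wedge [b]) =
        (\<lambda>Zs. if length Zs = 2 then A (pr01 (Zs ! 0)) (pr01 (Zs ! 1)) else 0)" (is "_ = ?\<beta>")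
      by (simp only: delbar_def Suc_1 bidegree_part_02[OF C lin alt])
    moreover have "?\<beta> = 0 \<longleftrightarrow> (\<forall>Z\<in>V01. \<forall>W\<in>V01. A Z W = 0)"
    proof
      assume \<beta>: "?\<beta> = 0"
      have "A (pr01 Z) (pr01 W) = 0" for Z W
        using fun_cong[OF \<beta>, of "[Z, W]"] by simp
      then show "\<forall>Z\<in>V01. \<forall>W\<in>V01. A Z W = 0"
        by (metis pr01_V01)
    qed (auto simp: pr01_in_V01)
    ultimately show ?thesis
      by (simp add: A_def)
  qed
  then show ?thesis
    unfolding dolbeault_cocycles_def bidegree_forms_01 by auto
qed

text \<open>\<open>BD\<close> is a basis of the derived algebra of \<open>V01\<close>, contained in
  the basis \<open>BU\<close> of \<open>V01\<close>. The coordinate forms of \<open>BU - BD\<close>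
  are a basis of the annihilator of the derived algebra, that is, of the cocycles; the coboundaries
  are zero.\<close>

lemma dolbeault_dim_01:
  assumes S: "finite S" "span S = (UNIV :: 'g set)"
    and BU: "finite BU" "cplx.independent BU" "BU \<subseteq> V01" "V01 \<subseteq> cplx.span BU"
    and BD: "BD \<subseteq> BU"
      "cplx.span BD = cplx.span {cbracket br Z W | Z W. Z \<in> V01 \<and> W \<in> V01}"
  shows "dolbeault_dim br J 0 1 = card (BU - BD)"
proof -
  let ?V = "dolbeault_cocycles br J 0 1"
  let ?r = "cplx.representation BU"
  define \<phi> where "\<phi> e = (\<lambda>Z. ?r (pr01 Z) e)" for e
  define w where "w e = wedge [\<phi> e]" for e
  have inspan: "pr01 Z \<in> cplx.span BU" for Z
    using BU(4) pr01_in_V01 by blast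
  have dual: "\<phi> e \<in> dual_eigenspace J (- \<i>)" for e
    using inspan BU(2) cplx.scale_minus_left
    by (auto simp: dual_eigenspace_def clinear_form_iff \<phi>_def pr01_add pr01_scale pr01_cmap
        cplx.representation_add cplx.representation_scale simp del: cplx.scale_minus_left)
  have \<phi>_basis: "\<phi> e f = (if f = e then 1 else 0)" if "f \<in> BU" for e f
    using that BU cplx.representation_basis[of BU f] by (auto simp: \<phi>_def pr01_V01 subset_eq)
  have \<phi>_zero: "\<phi> e (cbracket br Z W) = 0"
    if "e \<in> BU - BD" "Z \<in> V01" "W \<in> V01" for e Z W
  proof -
    have "cbracket br Z W \<in> cplx.span BD"
      unfolding BD using that by (intro cplx.span_base) auto
    then show ?thesis
    proof (induction rule: cplx.span_induct_alt)
      case base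
      then show ?case
        using dual[of e] by (auto simp: dual_eigenspace_def clinear_form_zero)
    next
      case (step c x y)
      have "x \<in> BU" "x \<noteq> e"
        using step(1) BD(1) that(1) by auto
      then show ?case
        using dual[of e] step(2) \<phi>_basis[of x e]
        by (simp add: dual_eigenspace_def clinear_form_add clinear_form_scale)
    qed
  qed
  have w_basis: "w e [f] = (if f = e then 1 else 0)" if "f \<in> BU" for e f
    using that by (simp add: w_def wedge_singleton \<phi>_basis)
  have inj: "inj_on w (BU - BD)"
    by (rule inj_onI) (metis DiffD1 w_basis zero_neq_one)
  have fin: "finite (BU - BD)"
    using BU(1) by simp
  have sum_w: "(\<Sum>b\<in>w ` (BU - BD). c b * b x) = (\<Sum>e\<in>BU - BD. c (w e) * w e x)" for c x
    by (simp add: sum.reindex[OF inj])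
  have "quotient_basis ?V {0} (w ` (BU - BD))"
    unfolding quotient_basis_def
  proof (intro conjI allI impI ballI)
    show "finite (w ` (BU - BD))"
      using fin by simp
    show "w ` (BU - BD) \<subseteq> ?V"
      unfolding cocycles_01[OF S] using dual \<phi>_zero by (auto simp: w_def)
  next
    fix c b
    assume 0: "(\<lambda>x. \<Sum>b\<in>w ` (BU - BD). c b * b x) \<in> {0}" and "b \<in> w ` (BU - BD)"
    then obtain e where e: "e \<in> BU - BD" "b = w e"
      by blast
    have "(\<Sum>f\<in>BU - BD. c (w f) * w f [e]) = 0"
      using fun_cong[OF singletonD[OF 0], of "[e]"] by (simp add: sum_w)
    moreover have "(\<Sum>f\<in>BU - BD. c (w f) * w f [e]) = (\<Sum>f\<in>BU - BD. if f = e then c (w f) else 0)"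
      using e by (intro sum.cong) (auto simp: w_basis)
    ultimately show "c b = 0"
      using e fin by simp
  next
    fix v assume "v \<in> ?V"
    then obtain b where b: "v = wedge [b]" "b \<in> dual_eigenspace J (- \<i>)"
      and b0: "\<And>Z W. Z \<in> V01 \<Longrightarrow> W \<in> V01 \<Longrightarrow> b (cbracket br Z W) = 0"
      unfolding cocycles_01[OF S] by blast
    have lin: "clinear_form b"
      using b by (simp add: dual_eigenspace_def)
    have bD: "b e = 0" if "e \<in> BD" for e
    proof -
      have "e \<in> cplx.span {cbracket br Z W | Z W. Z \<in> V01 \<and> W \<in> V01}"
        using that cplx.span_base[of e BD] BD(2) by simp
      then show ?thesis
        by (induction rule: cplx.span_induct_alt)
          (auto simp: b0 clinear_form_add[OF lin] clinear_form_scale[OF lin] clinear_form_zero[OF lin])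
    qed
    \<comment> \<open>\<open>b\<close> ignores the \<open>pr10\<close> component and vanishes on
      \<open>BD\<close>, so only coordinates from \<open>BU - BD\<close> remain.\<close>
    have expand: "b Z = (\<Sum>e\<in>BU - BD. b e * \<phi> e Z)" for Z
    proof -
      have "b Z = b (\<Sum>e\<in>BU. cscale (\<phi> e Z) e)"
        using cplx.sum_representation_eq[of BU "pr01 Z" BU] inspan BU dual01_comp_pr01[OF b(2), of Z]
        by (simp add: \<phi>_def)
      also have "\<dots> = (\<Sum>e\<in>BU. b e * \<phi> e Z)"
        by (simp add: clinear_form_sum[OF lin] clinear_form_scale[OF lin] mult.commute)
      also have "\<dots> = (\<Sum>e\<in>BU - BD. b e * \<phi> e Z)"
        using BU(1) BD(1) bD by (intro sum.mono_neutral_right) auto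
      finally show ?thesis .
    qed
    have "v Zs = (\<Sum>e\<in>BU - BD. b e * w e Zs)" for Zs
      using expand[of "Zs ! 0"] by (simp add: b(1) w_def wedge_singleton)
    \<comment> \<open>Coefficients in \<open>quotient_basis\<close> are indexed by the forms
      themselves, so they are transported through the inverse of \<open>w\<close>.\<close>
    moreover have "(\<Sum>e\<in>BU - BD. b e * w e Zs) =
        (\<Sum>x\<in>w ` (BU - BD). b (the_inv_into (BU - BD) w x) * x Zs)" for Zs
      by (simp add: sum_w the_inv_into_f_f[OF inj])
    ultimately have "v - (\<lambda>Zs. \<Sum>x\<in>w ` (BU - BD). b (the_inv_into (BU - BD) w x) * x Zs) \<in> {0}"
      by (simp add: fun_eq_iff)
    then show "\<exists>c. v - (\<lambda>Zs. \<Sum>x\<in>w ` (BU - BD). c x * x Zs) \<in> {0}"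
      by (rule exI[where x = "\<lambda>x. b (the_inv_into (BU - BD) w x)"])
  qed
  then have "quotient_dim ?V {0} = card (w ` (BU - BD))"
    by (rule quotient_dim_zero_eqI)
  then show ?thesis
    unfolding dolbeault_dim_def dolbeault_coboundaries_01 card_image[OF inj] .
qed

end

section \<open>The bounds 2 and 3 in real dimension 8\<close>

theorem proposition3p1:
  fixes br :: "'g::real_vector \<Rightarrow> 'g \<Rightarrow> 'g" and J :: "'g \<Rightarrow> 'g"
  assumes "nilpotent_lie_algebra br"
    and "dim (UNIV :: 'g set) = 8"
    and "SnN_complex_structure br J"
  shows "dolbeault_dim br J 0 1 = 2 \<or> dolbeault_dim br J 0 1 = 3"
proof -
  interpret lie_complex_structure br J
    using assms
    by (intro lie_complex_structure.intro)
      (simp_all add: nilpotent_lie_algebra_def SnN_complex_structure_def)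
  obtain n where n: "lower_central br n = {0}"
    using assms(1) by (auto simp: nilpotent_lie_algebra_def)
  obtain S :: "'g set" where "UNIV \<subseteq> span S" "card S = 8"
    using real_vector.basis_exists[of "UNIV :: 'g set"] assms(2) by metis
  \<comment> \<open>An infinite set has \<open>card\<close> equal to 0, so \<open>card S = 8\<close>
    also gives finiteness.\<close>
  then have S: "finite S" "span S = UNIV" "card S = 8"
    using card.infinite[of S] by fastforce+
  obtain C :: "'g complexification set" where C: "finite C" "cplx.independent C" "cplx.span C = UNIV"
    using finite_cplx_basis[OF S(1,2)] .

  let ?T = "{cbracket br Z W | Z W. Z \<in> V01 \<and> W \<in> V01}"
  let ?D = "cplx.span ?T"
  have "?D \<subseteq> V01"
    using V01_bracket_closed by (intro cplx.span_minimal V01_subspace) auto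
  obtain BD where BD: "BD \<subseteq> ?D" "cplx.independent BD" "?D \<subseteq> cplx.span BD"
    using cplx.maximal_independent_subset[of ?D] .
  obtain BU where BU: "BD \<subseteq> BU" "BU \<subseteq> V01" "cplx.independent BU" "V01 \<subseteq> cplx.span BU"
    using cplx.maximal_independent_subset_extend[OF subset_trans[OF BD(1) \<open>?D \<subseteq> V01\<close>] BD(2)] .
  have finBU: "finite BU"
    using cplx.independent_span_bound[OF C(1) BU(3)] by (simp add: C(3))
  have spanBD: "cplx.span BD = ?D"
    by (rule subset_antisym[OF cplx.span_minimal[OF BD(1) cplx.subspace_span] BD(3)])
  have dim: "dolbeault_dim br J 0 1 = card (BU - BD)"
    using dolbeault_dim_01[OF S(1,2) finBU BU(3,2,4,1) spanBD] .
  have "card BU \<le> 4"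
    using V01_independent_card[OF S(1,2) finBU BU(3,2)] S(3) by simp

  have "\<exists>Z\<in>V01. \<exists>W\<in>V01. cbracket br Z W \<noteq> 0"
  proof (rule ccontr)
    assume "\<not> ?thesis"
    then have "cbracket br (X, J X) (Y, J Y) = 0" for X Y
      by (auto simp: V01_def)
    \<comment> \<open>This is the real part of the vanishing bracket.\<close>
    then have abelian: "br (J X) (J Y) = br X Y" for X Y
      by (simp add: cbracket_def prod_eq_iff)
    have "(UNIV :: 'g set) \<noteq> {0}"
      using card_mono[of "{0}" S] S(3) by fastforce
    from nilpotent_center_nonzero[OF n this] obtain Y where Y: "Y \<noteq> 0" "\<And>X. br X Y = 0"
      by blast
    have "br Y X = 0" for X
      using Y(2) lie_bracket_anti[OF lie, of Y X] by simp
    moreover have "br (J Y) X = 0" for X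
    proof -
      \<comment> \<open>The relation \<open>abelian\<close> for \<open>J Y\<close> and
        \<open>X\<close>, with \<open>J (J Y) = - Y\<close>, trades the bracket with
        \<open>J Y\<close> for one with the central \<open>Y\<close>.\<close>
      have "br (J Y) X = br (- Y) (J X)"
        using abelian[of "J Y" X] by (simp only: J_J)
      also have "\<dots> = br (J X) Y"
        using lie_bracket_anti[OF lie, of "- Y" "J X"]
        by (simp only: bilinear_rneg[OF bilinear_br] minus_minus)
      finally show ?thesis
        by (simp only: Y(2))
    qed
    ultimately have "Y \<in> ascending_a1 br J"
      by (simp add: ascending_a1_def)
    then show False
      using assms(3) Y(1) by (simp add: SnN_complex_structure_def)
  qed

  then obtain Z W where ZW: "Z \<in> V01" "W \<in> V01" "cbracket br Z W \<noteq> 0"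
    by blast
  \<comment> \<open>A nonzero bracket makes the derived algebra nonzero, so at least one of the at
    most four basis vectors is discarded; this gives the upper bound 3.\<close>
  have "BD \<noteq> {}"
  proof
    assume "BD = {}"
    then have "?D = {0}"
      using spanBD by simp
    moreover have "cbracket br Z W \<in> ?D"
      using ZW by (intro cplx.span_base) auto
    ultimately show False
      using ZW by simp
  qed
  then have "card (BU - BD) < card BU"
    using BU(1) finBU by (intro psubset_card_mono) auto
  \<comment> \<open>With at most one basis vector outside \<open>BD\<close>, \<open>V01\<close>
    would lie in the span of some \<open>e\<close> and \<open>?D\<close>, and nilpotency would make
    every bracket on \<open>V01\<close> vanish.\<close>
  moreover have "\<not> card (BU - BD) \<le> 1"
  proof
    assume "card (BU - BD) \<le> 1"
    then have eq: "x = y" if "x \<in> BU - BD" "y \<in> BU - BD" for x y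
      using that finBU by (simp add: card_le_Suc0_iff_eq)
    have "\<exists>e. BU - BD \<subseteq> {e}"
    proof (cases "BU - BD = {}")
      case False
      then obtain e where "e \<in> BU - BD"
        by (meson all_not_in_conv)
      then have "BU - BD \<subseteq> {e}"
        using eq[OF _ \<open>e \<in> BU - BD\<close>] by (intro subsetI) simp
      then show ?thesis ..
    qed (metis empty_subsetI)
    then obtain e where "BU - BD \<subseteq> {e}" ..
    then have "BU \<subseteq> {e} \<union> BD"
      by (simp only: Diff_subset_conv Un_commute)
    also have "\<dots> \<subseteq> insert e ?D"
      using Un_mono[OF subset_refl BD(1), of "{e}"] by simp
    finally have "V01 \<subseteq> cplx.span (insert e ?D)"
      by (rule subset_trans[OF BU(4) cplx.span_mono])
    from nilpotent_codim1_bracket_zero[OF lie n this ZW(1,2)] show False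
      using ZW(3) by (rule notE[rotated])
  qed
  ultimately show ?thesis
    using dim \<open>card BU \<le> 4\<close> by linarith
qed

end
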